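(* Let $\mathrm{CL}_3(\wedge^\bullet,\vee^\bullet)$ be the extension of $\mathrm{CL}_3$ with binary connectives $\wedge^\bullet,\vee^\bullet$ (full left-sequential conjunction and disjunction) and their defining axioms $$x\wedge^\bullet y=(x\wedge y)\vee(y\wedge x),\qquad x\vee^\bullet y=\neg(\neg x\wedge^\bullet\neg y),$$ and define $\mathrm{CL}_2(\wedge^\bullet,\vee^\bullet)$ and $\mathrm{CL}(\wedge^\bullet,\vee^\bullet)$ as the extensions of $\mathrm{CL}_2$ and $\mathrm{CL}$ in the same way. Then $\mathrm{CL}_3(\wedge^\bullet,\vee^\bullet)$ incorporates Bochvar's three-valued strict logic, in the sense that all of the following equations (which completely axiomatise that logic) are derivable from $\mathrm{CL}_3(\wedge^\bullet,\vee^\bullet)$: (S1) $\neg\mathsf T=\mathsf F$; (S2) $\neg\mathsf U=\mathsf U$; (S3) $\neg\neg x=x$; (S4) $\neg(x\wedge^\bullet y)=\neg x\vee^\bullet\neg y$; (S6) $(x\wedge^\bullet y)\wedge^\bullet z=x\wedge^\bullet(y\wedge^\bullet z)$; (S7) $\mathsf T\wedge^\bullet x=x$; (S8) $x\vee^\bullet(\neg x\wedge^\bullet y)=x\vee^\bullet y$; (S9) $x\wedge^\bullet y=y\wedge^\bullet x$; (S10) $x\wedge^\bullet(y\vee^\bullet z)=(x\wedge^\bullet y)\vee^\bullet(x\wedge^\bullet z)$; (S11) $\mathsf U\wedge^\bullet x=\mathsf U$. Moreover, (S1), (S3), (S4), (S6), (S7), (S8), (S9) are derivable from $\mathrm{CL}_2(\wedge^\bullet,\vee^\bullet)$,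 and (S3), (S4), (S8), (S9), (S10) are derivable from $\mathrm{CL}(\wedge^\bullet,\vee^\bullet)$.
   Context: Derivability is in equational logic. $\wedge,\vee$ denote the (noncommutative) short-circuit conjunction and disjunction. $\mathrm{CL}$ (conditional logic of Guzmán and Squier) is the equational theory over $\{\neg,\wedge,\vee\}$ axiomatised by $\neg\neg x=x$; $\neg(x\wedge y)=\neg x\vee\neg y$; $(x\wedge y)\wedge z=x\wedge(y\wedge z)$; $x\wedge(y\vee z)=(x\wedge y)\vee(x\wedge z)$; $(x\vee y)\wedge z=(x\wedge z)\vee(\neg x\wedge y\wedge z)$ (bracketing immaterial by associativity); $x\vee(x\wedge y)=x$; $(x\wedge y)\vee(y\wedge x)=(y\wedge x)\vee(x\wedge y)$. $\mathrm{CL}_2$ adds constants $\mathsf T,\mathsf F$ and the axioms $\mathsf T\wedge x=x$, $\neg\mathsf T=\mathsf F$. $\mathrm{CL}_3$ adds to $\mathrm{CL}_2$ the constant $\mathsf U$ and the axiom $\neg\mathsf U=\mathsf U$. Bochvar's three-valued strict logic has truth values $\mathsf T,\mathsf F,\mathsf U$, where each connective returns $\mathsf U$ as soon as some argument is $\mathsf U$ and otherwise is the classical one. *)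

theory Defs
  imports Main
begin

section \<open>Terms and equations\<close>

datatype tm =
    Var nat
  | TT | FF | UU
  | Neg tm                    ("\<^bold>\<not> _" [80] 80)
  | Conj tm tm                (infixr "\<^bold>\<and>" 70)
  | Disj tm tm                (infixr "\<^bold>\<or>" 65)
  | FConj tm tm               (infixr "\<^bold>\<and>\<^sup>\<bullet>" 70)
  | FDisj tm tm               (infixr "\<^bold>\<or>\<^sup>\<bullet>" 65)

datatype opsym = sT | sF | sU | sNeg | sConj | sDisj | sFConj | sFDisj

primrec opsyms :: "tm \<Rightarrow> opsym set" where
  "opsyms (Var n) = {}"
| "opsyms TT = {sT}"
| "opsyms FF = {sF}"
| "opsyms UU = {sU}"
| "opsyms (\<^bold>\<not> s) = insert sNeg (opsyms s)"
| "opsyms (s \<^bold>\<and> t) = insert sConj (opsyms s \<union> opsyms t)"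
| "opsyms (s \<^bold>\<or> t) = insert sDisj (opsyms s \<union> opsyms t)"
| "opsyms (s \<^bold>\<and>\<^sup>\<bullet> t) = insert sFConj (opsyms s \<union> opsyms t)"
| "opsyms (s \<^bold>\<or>\<^sup>\<bullet> t) = insert sFDisj (opsyms s \<union> opsyms t)"

definition terms_over :: "opsym set \<Rightarrow> tm set" where
  "terms_over \<Sigma> = {t. opsyms t \<subseteq> \<Sigma>}"

primrec subst :: "(nat \<Rightarrow> tm) \<Rightarrow> tm \<Rightarrow> tm" where
  "subst \<sigma> (Var n) = \<sigma> n"
| "subst \<sigma> TT = TT"
| "subst \<sigma> FF = FF"
| "subst \<sigma> UU = UU"
| "subst \<sigma> (\<^bold>\<not> s) = \<^bold>\<not> subst \<sigma> s"
| "subst \<sigma> (s \<^bold>\<and> t) = subst \<sigma> s \<^bold>\<and> subst \<sigma> t"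
| "subst \<sigma> (s \<^bold>\<or> t) = subst \<sigma> s \<^bold>\<or> subst \<sigma> t"
| "subst \<sigma> (s \<^bold>\<and>\<^sup>\<bullet> t) = subst \<sigma> s \<^bold>\<and>\<^sup>\<bullet> subst \<sigma> t"
| "subst \<sigma> (s \<^bold>\<or>\<^sup>\<bullet> t) = subst \<sigma> s \<^bold>\<or>\<^sup>\<bullet> subst \<sigma> t"

type_synonym eqn = "tm \<times> tm"

abbreviation eqn :: "tm \<Rightarrow> tm \<Rightarrow> eqn" (infix "\<approx>" 50) where
  "s \<approx> t \<equiv> (s, t)"

section \<open>Equational logic\<close>

text \<open>An equational theory is a signature together with a set of axioms over it.  Derivations
  stay inside the signature: reflexivity, substitution and the congruence rules only introduce
  terms over it.\<close>

type_synonym eqthy = "opsym set \<times> eqn set"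

inductive derives :: "opsym set \<Rightarrow> eqn set \<Rightarrow> tm \<Rightarrow> tm \<Rightarrow> bool" for \<Sigma> E where
  axiom: "(s \<approx> t) \<in> E \<Longrightarrow> derives \<Sigma> E s t"
| refl: "t \<in> terms_over \<Sigma> \<Longrightarrow> derives \<Sigma> E t t"
| sym: "derives \<Sigma> E s t \<Longrightarrow> derives \<Sigma> E t s"
| trans: "derives \<Sigma> E s t \<Longrightarrow> derives \<Sigma> E t u \<Longrightarrow> derives \<Sigma> E s u"
| substitution: "derives \<Sigma> E s t \<Longrightarrow> (\<And>n. \<sigma> n \<in> terms_over \<Sigma>)
    \<Longrightarrow> derives \<Sigma> E (subst \<sigma> s) (subst \<sigma> t)"
| cong_Neg: "sNeg \<in> \<Sigma> \<Longrightarrow> derives \<Sigma> E s t \<Longrightarrow> derives \<Sigma> E (\<^bold>\<not> s) (\<^bold>\<not> t)"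
| cong_Conj: "sConj \<in> \<Sigma> \<Longrightarrow> derives \<Sigma> E s t \<Longrightarrow> derives \<Sigma> E s' t'
    \<Longrightarrow> derives \<Sigma> E (s \<^bold>\<and> s') (t \<^bold>\<and> t')"
| cong_Disj: "sDisj \<in> \<Sigma> \<Longrightarrow> derives \<Sigma> E s t \<Longrightarrow> derives \<Sigma> E s' t'
    \<Longrightarrow> derives \<Sigma> E (s \<^bold>\<or> s') (t \<^bold>\<or> t')"
| cong_FConj: "sFConj \<in> \<Sigma> \<Longrightarrow> derives \<Sigma> E s t \<Longrightarrow> derives \<Sigma> E s' t'
    \<Longrightarrow> derives \<Sigma> E (s \<^bold>\<and>\<^sup>\<bullet> s') (t \<^bold>\<and>\<^sup>\<bullet> t')"
| cong_FDisj: "sFDisj \<in> \<Sigma> \<Longrightarrow> derives \<Sigma> E s t \<Longrightarrow> derives \<Sigma> E s' t'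
    \<Longrightarrow> derives \<Sigma> E (s \<^bold>\<or>\<^sup>\<bullet> s') (t \<^bold>\<or>\<^sup>\<bullet> t')"

definition proves :: "eqthy \<Rightarrow> eqn \<Rightarrow> bool" (infix "\<turnstile>" 45) where
  "proves Th e = derives (fst Th) (snd Th) (fst e) (snd e)"

section \<open>Conditional logic and its extensions\<close>

abbreviation "x \<equiv> Var 0"
abbreviation "y \<equiv> Var 1"
abbreviation "z \<equiv> Var 2"

definition CL :: eqthy where
  "CL = ({sNeg, sConj, sDisj},
    {\<^bold>\<not> \<^bold>\<not> x \<approx> x,
     \<^bold>\<not> (x \<^bold>\<and> y) \<approx> \<^bold>\<not> x \<^bold>\<or> \<^bold>\<not> y,
     (x \<^bold>\<and> y) \<^bold>\<and> z \<approx> x \<^bold>\<and> (y \<^bold>\<and> z),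
     x \<^bold>\<and> (y \<^bold>\<or> z) \<approx> (x \<^bold>\<and> y) \<^bold>\<or> (x \<^bold>\<and> z),
     (x \<^bold>\<or> y) \<^bold>\<and> z \<approx> (x \<^bold>\<and> z) \<^bold>\<or> (\<^bold>\<not> x \<^bold>\<and> (y \<^bold>\<and> z)),
     x \<^bold>\<or> (x \<^bold>\<and> y) \<approx> x,
     (x \<^bold>\<and> y) \<^bold>\<or> (y \<^bold>\<and> x) \<approx> (y \<^bold>\<and> x) \<^bold>\<or> (x \<^bold>\<and> y)})"

definition CL2 :: eqthy where
  "CL2 = (fst CL \<union> {sT, sF}, snd CL \<union> {TT \<^bold>\<and> x \<approx> x, \<^bold>\<not> TT \<approx> FF})"

definition CL3 :: eqthy where
  "CL3 = (fst CL2 \<union> {sU}, snd CL2 \<union> {\<^bold>\<not> UU \<approx> UU})"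

definition with_full :: "eqthy \<Rightarrow> eqthy" where
  "with_full Th = (fst Th \<union> {sFConj, sFDisj},
    snd Th \<union>
    {x \<^bold>\<and>\<^sup>\<bullet> y \<approx> (x \<^bold>\<and> y) \<^bold>\<or> (y \<^bold>\<and> x),
     x \<^bold>\<or>\<^sup>\<bullet> y \<approx> \<^bold>\<not> (\<^bold>\<not> x \<^bold>\<and>\<^sup>\<bullet> \<^bold>\<not> y)})"

section \<open>Bochvar's strict logic\<close>

definition S1 :: eqn where "S1 = (\<^bold>\<not> TT \<approx> FF)"
definition S2 :: eqn where "S2 = (\<^bold>\<not> UU \<approx> UU)"
definition S3 :: eqn where "S3 = (\<^bold>\<not> \<^bold>\<not> x \<approx> x)"
definition S4 :: eqn where "S4 = (\<^bold>\<not> (x \<^bold>\<and>\<^sup>\<bullet> y) \<approx> \<^bold>\<not> x \<^bold>\<or>\<^sup>\<bullet> \<^bold>\<not> y)"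
definition S6 :: eqn where "S6 = ((x \<^bold>\<and>\<^sup>\<bullet> y) \<^bold>\<and>\<^sup>\<bullet> z \<approx> x \<^bold>\<and>\<^sup>\<bullet> (y \<^bold>\<and>\<^sup>\<bullet> z))"
definition S7 :: eqn where "S7 = (TT \<^bold>\<and>\<^sup>\<bullet> x \<approx> x)"
definition S8 :: eqn where "S8 = (x \<^bold>\<or>\<^sup>\<bullet> (\<^bold>\<not> x \<^bold>\<and>\<^sup>\<bullet> y) \<approx> x \<^bold>\<or>\<^sup>\<bullet> y)"
definition S9 :: eqn where "S9 = (x \<^bold>\<and>\<^sup>\<bullet> y \<approx> y \<^bold>\<and>\<^sup>\<bullet> x)"
definition S10 :: eqn where
  "S10 = (x \<^bold>\<and>\<^sup>\<bullet> (y \<^bold>\<or>\<^sup>\<bullet> z) \<approx> (x \<^bold>\<and>\<^sup>\<bullet> y) \<^bold>\<or>\<^sup>\<bullet> (x \<^bold>\<and>\<^sup>\<bullet> z))"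
definition S11 :: eqn where "S11 = (UU \<^bold>\<and>\<^sup>\<bullet> x \<approx> UU)"

definition bochvar_sig :: "opsym set" where
  "bochvar_sig = {sT, sF, sU, sNeg, sFConj, sFDisj}"

text \<open>The truth values are \<open>Some True\<close>, \<open>Some False\<close> and \<open>None\<close>, the last one being \<open>U\<close>.\<close>

definition strict2 :: "(bool \<Rightarrow> bool \<Rightarrow> bool) \<Rightarrow> bool option \<Rightarrow> bool option \<Rightarrow> bool option" where
  "strict2 f p q = Option.bind p (\<lambda>a. map_option (f a) q)"

text \<open>The short-circuit connectives are not in the signature of this logic, so their evaluation
  is left unspecified; it is only used on terms over \<^const>\<open>bochvar_sig\<close>.\<close>

primrec (nonexhaustive) bochvar_eval :: "(nat \<Rightarrow> bool option) \<Rightarrow> tm \<Rightarrow> bool option" where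
  "bochvar_eval v (Var n) = v n"
| "bochvar_eval v TT = Some True"
| "bochvar_eval v FF = Some False"
| "bochvar_eval v UU = None"
| "bochvar_eval v (\<^bold>\<not> s) = map_option Not (bochvar_eval v s)"
| "bochvar_eval v (s \<^bold>\<and>\<^sup>\<bullet> t) = strict2 (\<and>) (bochvar_eval v s) (bochvar_eval v t)"
| "bochvar_eval v (s \<^bold>\<or>\<^sup>\<bullet> t) = strict2 (\<or>) (bochvar_eval v s) (bochvar_eval v t)"

definition bochvar_valid :: "eqn \<Rightarrow> bool" where
  "bochvar_valid e = (\<forall>v. bochvar_eval v (fst e) = bochvar_eval v (snd e))"

definition completely_axiomatises_bochvar :: "eqn set \<Rightarrow> bool" where
  "completely_axiomatises_bochvar E \<longleftrightarrow>
    (\<forall>s \<in> terms_over bochvar_sig. \<forall>t \<in> terms_over bochvar_sig.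
      (bochvar_sig, E) \<turnstile> (s \<approx> t) \<longleftrightarrow> bochvar_valid (s \<approx> t))"

hide_const (open) x y z

end

(* In a conditional-logic algebra write 1_x for x | ~x (\<open>unit x\<close> below).  The full conjunction of x
   and y is then 1_y & x & y, the full disjunction is 1_y & (x | y), and 1_z for z either of these
   is 1_y & 1_x.  As units commute, the strict axioms reduce to moving units around.

   For the completeness of the strict axioms: a valid equation either has the constant U on both
   sides, and then both sides equal U, or has the same variables and the same Boolean content on
   both sides.  In the second case the Shannon expansion with respect to a variable that occurs in
   the term is derivable, so that the variables can be replaced by T and F one after the other.

   Derivability is equality in the Lindenbaum algebra, so both arguments can be carried out in
   arbitrary algebras. *)

theory Submission
  imports Defs
begin

section \<open>Algebras of conditional logic\<close>

locale full_cl_algebra =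
  fixes n :: "'a \<Rightarrow> 'a"
    and c :: "'a \<Rightarrow> 'a \<Rightarrow> 'a" (infixr "\<sqinter>" 70)
    and d :: "'a \<Rightarrow> 'a \<Rightarrow> 'a" (infixr "\<squnion>" 65)
    and fc :: "'a \<Rightarrow> 'a \<Rightarrow> 'a" (infixr "\<sqinter>\<^sup>\<bullet>" 70)
    and fd :: "'a \<Rightarrow> 'a \<Rightarrow> 'a" (infixr "\<squnion>\<^sup>\<bullet>" 65)
  assumes nn [simp]: "n (n x) = x"
    and n_c: "n (x \<sqinter> y) = n x \<squnion> n y"
    and c_assoc: "(x \<sqinter> y) \<sqinter> z = x \<sqinter> (y \<sqinter> z)"
    and c_d: "x \<sqinter> (y \<squnion> z) = (x \<sqinter> y) \<squnion> (x \<sqinter> z)"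
    and d_c_right: "(x \<squnion> y) \<sqinter> z = (x \<sqinter> z) \<squnion> (n x \<sqinter> (y \<sqinter> z))"
    and d_absorb: "x \<squnion> (x \<sqinter> y) = x"
    and cd_comm: "(x \<sqinter> y) \<squnion> (y \<sqinter> x) = (y \<sqinter> x) \<squnion> (x \<sqinter> y)"
    and fc_def: "x \<sqinter>\<^sup>\<bullet> y = (x \<sqinter> y) \<squnion> (y \<sqinter> x)"
    and fd_def: "x \<squnion>\<^sup>\<bullet> y = n (n x \<sqinter>\<^sup>\<bullet> n y)"
begin

section \<open>Dual laws, absorption and idempotence\<close>

lemma n_d: "n (x \<squnion> y) = n x \<sqinter> n y"
  by (metis nn n_c)

lemma d_assoc: "(x \<squnion> y) \<squnion> z = x \<squnion> (y \<squnion> z)"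
  by (metis nn n_d c_assoc)

lemma d_c: "x \<squnion> (y \<sqinter> z) = (x \<squnion> y) \<sqinter> (x \<squnion> z)"
  by (metis nn n_c n_d c_d)

lemma c_d_right: "(x \<sqinter> y) \<squnion> z = (x \<squnion> z) \<sqinter> (n x \<squnion> (y \<squnion> z))"
  by (metis nn n_c n_d d_c_right)

lemma c_absorb: "x \<sqinter> (x \<squnion> y) = x"
  by (metis nn n_c n_d d_absorb)

lemma dc_comm: "(x \<squnion> y) \<sqinter> (y \<squnion> x) = (y \<squnion> x) \<sqinter> (x \<squnion> y)"
  by (metis nn n_c n_d cd_comm)

lemma c_idem: "x \<sqinter> x = x"
  by (metis c_absorb d_absorb)

lemma d_idem: "x \<squnion> x = x"
  by (metis c_absorb d_absorb)

text \<open>In the three-valued reading \<open>x \<sqinter> n x\<close> is false or undefined but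
  never true, so a short-circuit conjunction never evaluates what follows it.\<close>

lemma c_n: "x \<sqinter> n x \<sqinter> y = x \<sqinter> n x"
  by (metis c_d_right d_absorb d_c_right d_idem nn)

lemma d_n: "x \<squnion> n x \<squnion> y = x \<squnion> n x"
  by (metis nn n_d c_n)

lemma c_nd: "x \<sqinter> (n x \<squnion> y) = x \<sqinter> y"
  by (metis c_absorb c_assoc c_d c_d_right)

lemma d_nc: "x \<squnion> (n x \<sqinter> y) = x \<squnion> y"
  by (metis nn n_c n_d c_nd)

text \<open>Instantiate \<open>cd_comm\<close> with \<open>x \<sqinter> y\<close> and
  \<open>x\<close>: by absorption one side collapses to \<open>x \<sqinter> y\<close>, the other to
  \<open>x \<sqinter> (y \<sqinter> x)\<close>.\<close>

lemma c_left_idem: "x \<sqinter> (y \<sqinter> x) = x \<sqinter> y"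
  by (metis c_assoc c_idem cd_comm d_absorb)

lemma d_left_idem: "x \<squnion> (y \<squnion> x) = x \<squnion> y"
  by (metis nn n_c n_d c_left_idem)

lemma c_middle_idem: "x \<sqinter> (y \<sqinter> (x \<sqinter> z)) = x \<sqinter> (y \<sqinter> z)"
  using arg_cong[OF c_left_idem[of x y], of "\<lambda>w. w \<sqinter> z"] by (simp add: c_assoc)

lemma d_middle_idem: "x \<squnion> (y \<squnion> (x \<squnion> z)) = x \<squnion> (y \<squnion> z)"
  using arg_cong[OF d_left_idem[of x y], of "\<lambda>w. w \<squnion> z"] by (simp add: d_assoc)

section \<open>Units: true where the argument is defined, undefined elsewhere\<close>

definition unit :: "'a \<Rightarrow> 'a" where "unit x = x \<squnion> n x"

text \<open>The product of \<open>x \<squnion> n x\<close> and \<open>n x \<squnion> x\<close>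
  equals its left factor, and \<open>dc_comm\<close> allows either of them to be the left
  one.\<close>

lemma unit_n: "unit (n x) = unit x"
proof -
  have "(x \<squnion> n x) \<sqinter> (n x \<squnion> x) = x \<squnion> n x" for x
    unfolding d_c_right using c_nd[of x x] by (simp add: c_idem c_absorb)
  from this[of x] this[of "n x"] show ?thesis
    using dc_comm[of x "n x"] by (simp add: unit_def)
qed

lemma n_unit: "n (unit x) = x \<sqinter> n x"
  unfolding unit_n[of x, symmetric] by (simp add: unit_def n_d)

lemma unit_c: "unit x \<sqinter> y = (x \<sqinter> y) \<squnion> (n x \<sqinter> y)"
  unfolding unit_def d_c_right
  by (simp add: c_assoc[symmetric] c_idem)

lemma unit_self: "unit x \<sqinter> x = x"
  by (simp add: unit_c c_idem d_nc d_idem)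

lemma unit_unit: "unit (unit x) = unit x"
  unfolding unit_def[of "unit x"] unfolding unit_def by (simp add: d_assoc d_n n_d)

text \<open>A unit acts like its negation from the other side: both are \<open>U\<close> when \<open>x\<close> is, and neutral
  otherwise.\<close>

lemma n_unit_d: "n (unit x) \<squnion> y = unit x \<sqinter> y"
proof -
  have "unit x \<sqinter> y = (x \<squnion> (n x \<sqinter> y)) \<sqinter> (n x \<squnion> (y \<squnion> (n x \<sqinter> y)))"
    unfolding unit_c by (rule c_d_right)
  also have "\<dots> = (x \<squnion> y) \<sqinter> (n x \<squnion> y)"
    by (simp add: d_nc d_c[of y] d_c[of "n x"] d_left_idem d_idem c_idem)
  also have "\<dots> = n (unit x) \<squnion> y"
    unfolding n_unit c_d_right by (simp add: d_assoc[symmetric] d_idem)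
  finally show ?thesis by simp
qed

section \<open>Full connectives as short-circuit ones behind a unit\<close>

lemma fc_comm: "x \<sqinter>\<^sup>\<bullet> y = y \<sqinter>\<^sup>\<bullet> x"
  unfolding fc_def by (rule cd_comm)

text \<open>Swapping the disjuncts of the definition brings \<open>y\<close> to the front;
  distributing twice then splits on \<open>y\<close>, and both branches recombine into a
  unit.\<close>

lemma fc_eq: "x \<sqinter>\<^sup>\<bullet> y = unit y \<sqinter> x \<sqinter> y"
proof -
  have "x \<sqinter>\<^sup>\<bullet> y = (y \<sqinter> x) \<squnion> (x \<sqinter> y)"
    unfolding fc_def by (rule cd_comm)
  also have "\<dots> = (y \<squnion> (x \<sqinter> y)) \<sqinter> (n y \<squnion> (x \<squnion> (x \<sqinter> y)))"
    by (rule c_d_right)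
  also have "\<dots> = (y \<squnion> x) \<sqinter> (y \<sqinter> x)"
    by (simp add: d_c[of y] d_idem d_absorb c_assoc c_nd)
  also have "\<dots> = (y \<sqinter> x) \<squnion> (n y \<sqinter> (x \<sqinter> y))"
    unfolding d_c_right by (simp add: c_left_idem c_assoc[symmetric] c_idem)
  also have "\<dots> = unit y \<sqinter> x \<sqinter> y"
    unfolding unit_c by (simp add: c_left_idem)
  finally show ?thesis .
qed

text \<open>De Morgan leaves a negated unit as the first disjunct; \<open>n_unit_d\<close> makes it
  a conjunctive unit again, so both full connectives have the same shape.\<close>

lemma fd_eq: "x \<squnion>\<^sup>\<bullet> y = unit y \<sqinter> (x \<squnion> y)"
  unfolding fd_def fc_eq
  by (simp add: n_c unit_n n_unit_d)

lemma unit_c_d: "unit x \<sqinter> (x \<squnion> y) = x \<squnion> y"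
proof -
  have "unit x \<sqinter> (x \<squnion> y) = x \<squnion> ((x \<sqinter> n x) \<squnion> y)"
    unfolding c_d unit_self n_unit_d[symmetric] n_unit ..
  then show ?thesis by (simp add: d_assoc[symmetric] d_absorb)
qed

text \<open>By \<open>fc_eq\<close> the full conjunction of two units is their short-circuit
  conjunction in reverse order, and full conjunction commutes.\<close>

lemma unit_comm: "unit x \<sqinter> unit y = unit y \<sqinter> unit x"
  using fc_comm[of "unit x" "unit y"] unfolding fc_eq by (simp add: unit_unit c_left_idem)

lemma unit_c_eq: "unit (x \<sqinter> y) = unit x \<sqinter> (n x \<squnion> unit y)"
proof -
  have "unit (x \<sqinter> y) = (x \<squnion> (n x \<squnion> n y)) \<sqinter> (n x \<squnion> (y \<squnion> (n x \<squnion> n y)))"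
    unfolding unit_def n_c by (rule c_d_right)
  then show ?thesis by (simp add: d_n d_middle_idem unit_def)
qed

text \<open>In \<open>x \<sqinter> y\<close> alone the definedness of \<open>y\<close> matters only
  when \<open>x\<close> is true; the unit of \<open>y\<close> that \<open>fc_eq\<close> puts in
  front removes this dependence.\<close>

lemma unit_fc: "unit (x \<sqinter>\<^sup>\<bullet> y) = unit y \<sqinter> unit x"
proof -
  have "unit (x \<sqinter>\<^sup>\<bullet> y) = unit y \<sqinter> unit (x \<sqinter> y)"
    unfolding fc_eq unit_c_eq[of "unit y"] unit_unit c_nd ..
  also have "\<dots> = unit y \<sqinter> ((x \<sqinter> unit y) \<squnion> n x)"
    unfolding unit_c_eq unit_c[of x]
    by (simp add: c_nd c_absorb)
  also have "\<dots> = unit y \<sqinter> unit x"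
    by (simp add: c_d c_left_idem unit_def[of x])
  finally show ?thesis .
qed

lemma unit_fd: "unit (x \<squnion>\<^sup>\<bullet> y) = unit y \<sqinter> unit x"
  unfolding fd_def by (simp add: unit_n unit_fc)

lemma fc_assoc: "(x \<sqinter>\<^sup>\<bullet> y) \<sqinter>\<^sup>\<bullet> z = x \<sqinter>\<^sup>\<bullet> (y \<sqinter>\<^sup>\<bullet> z)" (is "?l = ?r")
proof -
  have "?l = (unit z \<sqinter> unit y) \<sqinter> (x \<sqinter> y \<sqinter> z)"
    unfolding fc_eq by (simp add: c_assoc)
  \<comment> \<open>A factor may be repeated further to the right, so \<open>unit z\<close> is
    inserted where the right-hand side has it.\<close>
  also have "\<dots> = (unit z \<sqinter> unit y) \<sqinter> (x \<sqinter> unit z \<sqinter> y \<sqinter> z)"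
    using c_middle_idem[of "unit z" "unit y \<sqinter> x" "y \<sqinter> z"] by (simp add: c_assoc)
  also have "\<dots> = ?r"
    unfolding fc_eq[of x "y \<sqinter>\<^sup>\<bullet> z"] unit_fc unfolding fc_eq by (simp add: c_assoc)
  finally show ?thesis .
qed

lemma n_fc: "n (x \<sqinter>\<^sup>\<bullet> y) = n x \<squnion>\<^sup>\<bullet> n y"
  by (simp add: fd_def)

lemma fd_fc_absorb: "x \<squnion>\<^sup>\<bullet> (n x \<sqinter>\<^sup>\<bullet> y) = x \<squnion>\<^sup>\<bullet> y"
proof -
  have "x \<squnion>\<^sup>\<bullet> (n x \<sqinter>\<^sup>\<bullet> y) = (unit y \<sqinter> unit x) \<sqinter> (x \<squnion> (unit y \<sqinter> n x \<sqinter> y))"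
    unfolding fd_eq unit_fc unit_n unfolding fc_eq ..
  \<comment> \<open>Once the outer units are distributed over the disjunction, the inner
    \<open>unit y\<close> is a repetition.\<close>
  also have "\<dots> = unit y \<sqinter> unit x \<sqinter> (x \<squnion> (n x \<sqinter> y))"
    by (simp add: c_d c_assoc c_middle_idem)
  also have "\<dots> = unit y \<sqinter> unit x \<sqinter> (x \<squnion> y)"
    unfolding d_nc ..
  also have "\<dots> = x \<squnion>\<^sup>\<bullet> y"
    unfolding fd_eq unit_c_d ..
  finally show ?thesis .
qed

lemma fc_fd: "x \<sqinter>\<^sup>\<bullet> (y \<squnion>\<^sup>\<bullet> z) = (x \<sqinter>\<^sup>\<bullet> y) \<squnion>\<^sup>\<bullet> (x \<sqinter>\<^sup>\<bullet> z)" (is "?l = ?r")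
proof -
  \<comment> \<open>The right-hand side starts with units of all three arguments; by commutativity
    the left-hand side also absorbs \<open>unit x\<close>.\<close>
  have absorb: "?l = unit x \<sqinter> ?l"
    unfolding fc_comm[of x] fc_eq[of _ x] by (simp add: c_assoc[symmetric] c_idem)
  have "?l = (unit z \<sqinter> unit y) \<sqinter> x \<sqinter> unit z \<sqinter> (y \<squnion> z)"
    unfolding fc_eq[of x] unit_fd unfolding fd_eq ..
  also have "\<dots> = unit z \<sqinter> unit y \<sqinter> x \<sqinter> (y \<squnion> z)"
    using c_middle_idem[of "unit z" "unit y \<sqinter> x" "y \<squnion> z"] by (simp add: c_assoc)
  finally have l: "?l = unit x \<sqinter> unit z \<sqinter> unit y \<sqinter> x \<sqinter> (y \<squnion> z)"
    by (subst absorb) (rule arg_cong)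
  have "?r = (unit z \<sqinter> unit x) \<sqinter> ((unit y \<sqinter> x \<sqinter> y) \<squnion> (unit z \<sqinter> x \<sqinter> z))"
    unfolding fd_eq unit_fc unfolding fc_eq ..
  \<comment> \<open>Rewritten as the disjunct \<open>n (unit y)\<close>, the unit leaves the
    disjunction by associativity.\<close>
  also have "(unit y \<sqinter> x \<sqinter> y) \<squnion> (unit z \<sqinter> x \<sqinter> z) = unit y \<sqinter> ((x \<sqinter> y) \<squnion> (unit z \<sqinter> x \<sqinter> z))"
    by (simp add: n_unit_d[symmetric] d_assoc)
  also have "(unit z \<sqinter> unit x) \<sqinter> \<dots> = unit z \<sqinter> unit x \<sqinter> unit y \<sqinter> x \<sqinter> (y \<squnion> z)"
    using c_middle_idem[of "unit z" "unit x \<sqinter> unit y"]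
    by (simp add: c_d c_assoc)
  finally show ?thesis
    unfolding l c_assoc[symmetric] unit_comm[of x z] by simp
qed

lemma fc_neutral:
  assumes "\<And>x. t \<sqinter> x = x"
  shows "t \<sqinter>\<^sup>\<bullet> x = x"
  unfolding fc_def by (simp add: assms d_absorb)

text \<open>A fixed point of negation is its own unit and equals \<open>u \<sqinter> n u\<close>,
  which swallows everything to its right by \<open>c_n\<close>.\<close>

lemma fc_undefined:
  assumes "n u = u"
  shows "u \<sqinter>\<^sup>\<bullet> x = u"
proof -
  have "unit u = u" by (simp add: unit_def assms d_idem)
  then have "x \<sqinter>\<^sup>\<bullet> u = u \<sqinter> n u \<sqinter> (x \<sqinter> u)"
    unfolding fc_eq by (simp add: assms c_left_idem c_assoc[of u u, symmetric] c_idem)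
  also have "\<dots> = u" by (simp only: c_n) (simp add: assms c_idem)
  finally show ?thesis by (simp add: fc_comm)
qed

end

section \<open>Algebras of strict logic\<close>

primrec vars :: "tm \<Rightarrow> nat set" where
  "vars (Var i) = {i}"
| "vars TT = {}"
| "vars FF = {}"
| "vars UU = {}"
| "vars (\<^bold>\<not> s) = vars s"
| "vars (s \<^bold>\<and> t) = vars s \<union> vars t"
| "vars (s \<^bold>\<or> t) = vars s \<union> vars t"
| "vars (s \<^bold>\<and>\<^sup>\<bullet> t) = vars s \<union> vars t"
| "vars (s \<^bold>\<or>\<^sup>\<bullet> t) = vars s \<union> vars t"

lemma finite_vars: "finite (vars t)"
  by (induction t) auto

lemma terms_over_simps [simp]:
  "Var i \<in> terms_over \<Sigma>"
  "TT \<in> terms_over \<Sigma> \<longleftrightarrow> sT \<in> \<Sigma>"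
  "FF \<in> terms_over \<Sigma> \<longleftrightarrow> sF \<in> \<Sigma>"
  "UU \<in> terms_over \<Sigma> \<longleftrightarrow> sU \<in> \<Sigma>"
  "(\<^bold>\<not> s) \<in> terms_over \<Sigma> \<longleftrightarrow> sNeg \<in> \<Sigma> \<and> s \<in> terms_over \<Sigma>"
  "s \<^bold>\<and> t \<in> terms_over \<Sigma> \<longleftrightarrow> sConj \<in> \<Sigma> \<and> s \<in> terms_over \<Sigma> \<and> t \<in> terms_over \<Sigma>"
  "s \<^bold>\<or> t \<in> terms_over \<Sigma> \<longleftrightarrow> sDisj \<in> \<Sigma> \<and> s \<in> terms_over \<Sigma> \<and> t \<in> terms_over \<Sigma>"
  "s \<^bold>\<and>\<^sup>\<bullet> t \<in> terms_over \<Sigma> \<longleftrightarrow> sFConj \<in> \<Sigma> \<and> s \<in> terms_over \<Sigma> \<and> t \<in> terms_over \<Sigma>"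
  "s \<^bold>\<or>\<^sup>\<bullet> t \<in> terms_over \<Sigma> \<longleftrightarrow> sFDisj \<in> \<Sigma> \<and> s \<in> terms_over \<Sigma> \<and> t \<in> terms_over \<Sigma>"
  by (auto simp: terms_over_def)

text \<open>Omits the short-circuit connectives, on which the evaluation functions are
  unspecified.\<close>

lemma bochvar_induct [consumes 1, case_names Var TT FF UU Neg FConj FDisj]:
  assumes "t \<in> terms_over bochvar_sig"
    and "\<And>i. P (Var i)" "P TT" "P FF" "P UU"
    and "\<And>s. s \<in> terms_over bochvar_sig \<Longrightarrow> P s \<Longrightarrow> P (\<^bold>\<not> s)"
    and "\<And>s t. s \<in> terms_over bochvar_sig \<Longrightarrow> P s \<Longrightarrow> t \<in> terms_over bochvar_sig \<Longrightarrow> P t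
      \<Longrightarrow> P (s \<^bold>\<and>\<^sup>\<bullet> t)"
    and "\<And>s t. s \<in> terms_over bochvar_sig \<Longrightarrow> P s \<Longrightarrow> t \<in> terms_over bochvar_sig \<Longrightarrow> P t
      \<Longrightarrow> P (s \<^bold>\<or>\<^sup>\<bullet> t)"
  shows "P t"
  using assms(1) by (induction t) (auto simp: bochvar_sig_def intro: assms(2-)[unfolded bochvar_sig_def])

lemma bochvar_eval_None_iff:
  "t \<in> terms_over bochvar_sig \<Longrightarrow>
    bochvar_eval v t = None \<longleftrightarrow> sU \<in> opsyms t \<or> (\<exists>i \<in> vars t. v i = None)"
  by (induction t rule: bochvar_induct) (auto simp: strict2_def Option.bind_eq_None_conv)

lemma bochvar_valid_opsyms_iff:
  assumes "s \<in> terms_over bochvar_sig" "t \<in> terms_over bochvar_sig" "bochvar_valid (s \<approx> t)"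
  shows "sU \<in> opsyms s \<longleftrightarrow> sU \<in> opsyms t"
proof -
  \<comment> \<open>Under a total valuation the constant \<open>UU\<close> is the only source of
    undefinedness.\<close>
  have "bochvar_eval (\<lambda>i. Some True) s = bochvar_eval (\<lambda>i. Some True) t"
    using assms(3) by (simp add: bochvar_valid_def)
  then show ?thesis
    using bochvar_eval_None_iff[OF assms(1)] bochvar_eval_None_iff[OF assms(2)]
    by (metis option.distinct(1))
qed

lemma bochvar_valid_vars_eq:
  assumes "s \<in> terms_over bochvar_sig" "t \<in> terms_over bochvar_sig" "bochvar_valid (s \<approx> t)"
    and "sU \<notin> opsyms s"
  shows "vars s = vars t"
proof -
  have "i \<in> vars s \<longleftrightarrow> i \<in> vars t" for i
  proof -
    \<comment> \<open>With only \<open>i\<close> undefined, the value reveals whether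
      \<open>i\<close> occurs.\<close>
    let ?v = "\<lambda>j. if j = i then None else Some True"
    have "bochvar_eval ?v s = bochvar_eval ?v t"
      using assms(3) by (simp add: bochvar_valid_def)
    then show ?thesis
      using bochvar_eval_None_iff[OF assms(1), of ?v] bochvar_eval_None_iff[OF assms(2), of ?v]
        assms(4) bochvar_valid_opsyms_iff[OF assms(1-3)]
      by (auto split: if_splits)
  qed
  then show ?thesis by blast
qed

locale bochvar_algebra =
  fixes n :: "'a \<Rightarrow> 'a"
    and c :: "'a \<Rightarrow> 'a \<Rightarrow> 'a" (infixr "\<sqinter>" 70)
    and d :: "'a \<Rightarrow> 'a \<Rightarrow> 'a" (infixr "\<squnion>" 65)
    and tt ff uu :: 'a
  assumes n_tt: "n tt = ff"
    and n_uu: "n uu = uu"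
    and nn [simp]: "n (n x) = x"
    and n_c: "n (x \<sqinter> y) = n x \<squnion> n y"
    and c_assoc: "(x \<sqinter> y) \<sqinter> z = x \<sqinter> (y \<sqinter> z)"
    and tt_c: "tt \<sqinter> x = x"
    and d_nc: "x \<squnion> (n x \<sqinter> y) = x \<squnion> y"
    and c_comm: "x \<sqinter> y = y \<sqinter> x"
    and c_d: "x \<sqinter> (y \<squnion> z) = (x \<sqinter> y) \<squnion> (x \<sqinter> z)"
    and uu_c: "uu \<sqinter> x = uu"
begin

section \<open>Elementary consequences of the strict axioms\<close>

lemma n_ff: "n ff = tt"
  unfolding n_tt[symmetric] by simp

lemma n_d: "n (x \<squnion> y) = n x \<sqinter> n y"
  using n_c[of "n x" "n y"] by (metis nn)

lemma d_eq: "x \<squnion> y = n (n x \<sqinter> n y)"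
  by (simp add: n_c)

lemma c_tt: "x \<sqinter> tt = x" and c_uu: "x \<sqinter> uu = uu"
  using c_comm[of x] by (simp_all add: tt_c uu_c)

lemma d_comm: "x \<squnion> y = y \<squnion> x" and d_assoc: "(x \<squnion> y) \<squnion> z = x \<squnion> (y \<squnion> z)"
  and ff_d: "ff \<squnion> x = x" and d_ff: "x \<squnion> ff = x"
  and uu_d: "uu \<squnion> x = uu" and d_uu: "x \<squnion> uu = uu"
  unfolding d_eq by (simp_all add: c_comm[of "n x"] c_assoc n_ff tt_c n_uu uu_c)

lemma c_nd: "x \<sqinter> (n x \<squnion> y) = x \<sqinter> y"
  using arg_cong[OF d_nc[of "n x" "n y"], of n] by (simp add: n_d n_c)

lemma d_c: "x \<squnion> (y \<sqinter> z) = (x \<squnion> y) \<sqinter> (x \<squnion> z)"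
  using arg_cong[OF c_d[of "n x" "n y" "n z"], of n] by (simp add: n_d n_c)

lemma c_n: "x \<sqinter> n x = x \<sqinter> ff" and d_n: "x \<squnion> n x = x \<squnion> tt"
  using c_nd[of x ff] d_nc[of x tt] by (simp_all add: d_ff c_tt)

text \<open>Here \<open>x \<squnion> tt\<close> is the unit of \<open>x\<close>. By
  \<open>d_n\<close> and commutativity it equals \<open>n x \<squnion> tt\<close>, which
  \<open>c_nd\<close> reduces to \<open>tt\<close> behind \<open>x\<close>.\<close>

lemma c_unit: "x \<sqinter> (x \<squnion> tt) = x"
  using c_nd[of x x] c_nd[of x tt] d_n[of x] d_n[of "n x"] by (simp add: c_tt d_comm)

lemma c_idem: "x \<sqinter> x = x"
  using c_nd[of x x] c_unit[of x] d_n[of x] by (simp add: d_comm)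

lemma d_idem: "x \<squnion> x = x"
  unfolding d_eq by (simp add: c_idem)

text \<open>Two ways to say that \<open>x\<close> is undefined whenever \<open>y\<close> is. Both
  left-hand sides equal \<open>x \<squnion> (x \<sqinter> y)\<close>.\<close>

lemma unit_iff: "x \<sqinter> (y \<squnion> tt) = x \<longleftrightarrow> x \<squnion> (y \<sqinter> ff) = x"
proof -
  have "x \<sqinter> (y \<squnion> tt) = x \<squnion> (x \<sqinter> y)"
    by (simp add: c_d c_tt d_comm)
  also have "\<dots> = x \<sqinter> (x \<squnion> y)"
    by (simp only: d_c d_idem)
  also have "\<dots> = x \<squnion> (y \<sqinter> ff)"
    by (simp only: d_c d_ff c_comm[of x])
  finally show ?thesis by simp
qed

section \<open>Evaluation in a strict algebra and Shannon expansion\<close>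

primrec (nonexhaustive) val :: "(nat \<Rightarrow> 'a) \<Rightarrow> tm \<Rightarrow> 'a" where
  "val \<rho> (Var i) = \<rho> i"
| "val \<rho> TT = tt"
| "val \<rho> FF = ff"
| "val \<rho> UU = uu"
| "val \<rho> (\<^bold>\<not> s) = n (val \<rho> s)"
| "val \<rho> (s \<^bold>\<and>\<^sup>\<bullet> t) = val \<rho> s \<sqinter> val \<rho> t"
| "val \<rho> (s \<^bold>\<or>\<^sup>\<bullet> t) = val \<rho> s \<squnion> val \<rho> t"

lemma val_cong:
  "t \<in> terms_over bochvar_sig \<Longrightarrow> (\<And>i. i \<in> vars t \<Longrightarrow> \<rho> i = \<rho>' i) \<Longrightarrow> val \<rho> t = val \<rho>' t"
  by (induction t rule: bochvar_induct) auto

lemma val_undefined: "t \<in> terms_over bochvar_sig \<Longrightarrow> sU \<in> opsyms t \<Longrightarrow> val \<rho> t = uu"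
  by (induction t rule: bochvar_induct) (auto simp: uu_c c_uu uu_d d_uu n_uu)

text \<open>Equality after conjoining \<open>a\<close> is a congruence for the strict connectives,
  so it passes from the variables to all strict terms.\<close>

lemma c_val_upd:
  assumes "t \<in> terms_over bochvar_sig" and a: "a \<sqinter> \<rho> i = a \<sqinter> w"
  shows "a \<sqinter> val \<rho> t = a \<sqinter> val (\<rho>(i := w)) t"
  using assms(1)
proof (induction t rule: bochvar_induct)
  case (Neg s)
  \<comment> \<open>Inserting \<open>a\<close> below the negation makes the induction hypothesis
    applicable.\<close>
  have "a \<sqinter> n x = a \<sqinter> n (a \<sqinter> x)" for x
    using c_nd[of a "n x"] by (simp add: n_c)
  then show ?case using Neg.IH by (metis val.simps(5))
next
  case (FConj s t)
  have "a \<sqinter> (x \<sqinter> y) = (a \<sqinter> x) \<sqinter> (a \<sqinter> y)" for x y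
    by (metis c_assoc c_comm c_idem)
  then show ?case using FConj.IH by simp
qed (simp_all add: a c_d)

text \<open>Strictness in algebraic form. Negations and disjunctions are treated through the
  disjunctive version in \<open>unit_iff\<close>.\<close>

lemma val_c_unit:
  "t \<in> terms_over bochvar_sig \<Longrightarrow> i \<in> vars t \<Longrightarrow> val \<rho> t \<sqinter> (\<rho> i \<squnion> tt) = val \<rho> t"
proof (induction t rule: bochvar_induct)
  case (Neg s)
  then have "n (val \<rho> s \<sqinter> (\<rho> i \<squnion> tt)) = n (val \<rho> s)" by simp
  moreover have "n (\<rho> i \<squnion> tt) = \<rho> i \<sqinter> ff"
    using c_n[of "\<rho> i"] d_n[of "\<rho> i"] by (metis n_d nn c_comm)
  ultimately show ?case by (simp add: n_c unit_iff)
next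
  case (FConj s t)
  then consider "val \<rho> s \<sqinter> (\<rho> i \<squnion> tt) = val \<rho> s" | "val \<rho> t \<sqinter> (\<rho> i \<squnion> tt) = val \<rho> t"
    by auto
  then show ?case
  proof cases
    case 1
    have "val \<rho> (s \<^bold>\<and>\<^sup>\<bullet> t) \<sqinter> (\<rho> i \<squnion> tt) = (val \<rho> s \<sqinter> (\<rho> i \<squnion> tt)) \<sqinter> val \<rho> t"
      by (simp add: c_assoc c_comm[of "val \<rho> t"])
    also have "\<dots> = val \<rho> (s \<^bold>\<and>\<^sup>\<bullet> t)" by (simp add: 1)
    finally show ?thesis .
  next
    case 2
    then show ?thesis by (simp add: c_assoc)
  qed
next
  case (FDisj s t)
  then consider "val \<rho> s \<squnion> (\<rho> i \<sqinter> ff) = val \<rho> s" | "val \<rho> t \<squnion> (\<rho> i \<sqinter> ff) = val \<rho> t"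
    unfolding unit_iff vars.simps by blast
  then show ?case
    unfolding unit_iff
  proof cases
    case 1
    have "val \<rho> (s \<^bold>\<or>\<^sup>\<bullet> t) \<squnion> (\<rho> i \<sqinter> ff) = (val \<rho> s \<squnion> (\<rho> i \<sqinter> ff)) \<squnion> val \<rho> t"
      by (simp add: d_assoc d_comm[of "val \<rho> t"])
    also have "\<dots> = val \<rho> (s \<^bold>\<or>\<^sup>\<bullet> t)" by (simp add: 1)
    finally show "val \<rho> (s \<^bold>\<or>\<^sup>\<bullet> t) \<squnion> (\<rho> i \<sqinter> ff) = val \<rho> (s \<^bold>\<or>\<^sup>\<bullet> t)" .
  next
    case 2
    then show "val \<rho> (s \<^bold>\<or>\<^sup>\<bullet> t) \<squnion> (\<rho> i \<sqinter> ff) = val \<rho> (s \<^bold>\<or>\<^sup>\<bullet> t)"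
      by (simp add: d_assoc)
  qed
qed (auto simp: c_unit)

text \<open>The occurrence of \<open>i\<close> permits the factor
  \<open>\<rho> i \<squnion> n (\<rho> i)\<close>. Behind \<open>\<rho> i\<close> the variable acts
  as \<open>tt\<close>, behind \<open>n (\<rho> i)\<close> as \<open>ff\<close>.\<close>

lemma shannon_expansion:
  assumes t: "t \<in> terms_over bochvar_sig" "i \<in> vars t"
  shows "val \<rho> t = (\<rho> i \<sqinter> val (\<rho>(i := tt)) t) \<squnion> (n (\<rho> i) \<sqinter> val (\<rho>(i := ff)) t)"
proof -
  have "val \<rho> t = (\<rho> i \<squnion> n (\<rho> i)) \<sqinter> val \<rho> t"
    using val_c_unit[OF t, of \<rho>] by (simp add: d_n c_comm)
  also have "\<dots> = (\<rho> i \<sqinter> val \<rho> t) \<squnion> (n (\<rho> i) \<sqinter> val \<rho> t)"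
    by (simp add: c_comm[of _ "val \<rho> t"] c_d)
  also have "\<rho> i \<sqinter> val \<rho> t = \<rho> i \<sqinter> val (\<rho>(i := tt)) t"
    by (rule c_val_upd[OF t(1)]) (simp add: c_idem c_tt)
  also have "n (\<rho> i) \<sqinter> val \<rho> t = n (\<rho> i) \<sqinter> val (\<rho>(i := ff)) t"
    by (rule c_val_upd[OF t(1)]) (use c_n[of "n (\<rho> i)"] in simp)
  finally show ?thesis .
qed

fun embed :: "bool option \<Rightarrow> 'a" where
  "embed (Some True) = tt"
| "embed (Some False) = ff"
| "embed None = uu"

lemma val_embed: "t \<in> terms_over bochvar_sig \<Longrightarrow> val (\<lambda>i. embed (v i)) t = embed (bochvar_eval v t)"
proof (induction t rule: bochvar_induct)
  case (Neg s)
  then show ?case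
    by (cases "bochvar_eval v s" rule: embed.cases) (auto simp: n_tt n_ff n_uu)
next
  case (FConj s t)
  then show ?case
    by (cases "bochvar_eval v s" rule: embed.cases; cases "bochvar_eval v t" rule: embed.cases)
      (auto simp: strict2_def tt_c c_tt uu_c c_uu c_idem)
next
  case (FDisj s t)
  then show ?case
    by (cases "bochvar_eval v s" rule: embed.cases; cases "bochvar_eval v t" rule: embed.cases)
      (auto simp: strict2_def ff_d d_ff uu_d d_uu d_idem)
qed auto

theorem val_eq_if_bochvar_valid:
  assumes s: "s \<in> terms_over bochvar_sig" and t: "t \<in> terms_over bochvar_sig"
    and valid: "bochvar_valid (s \<approx> t)"
  shows "val \<rho> s = val \<rho> t"
proof (cases "sU \<in> opsyms s")
  case True
  then show ?thesis
    using bochvar_valid_opsyms_iff[OF assms] val_undefined s t by metis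
next
  case False
  have vars: "vars s = vars t"
    by (rule bochvar_valid_vars_eq[OF assms False])
  \<comment> \<open>\<open>W\<close> contains the variables not yet replaced by constants; each
    induction step expands one of them on both sides.\<close>
  have "val \<rho> s = val \<rho> t"
    if "finite W" "W \<subseteq> vars t" "\<forall>i \<in> vars t - W. \<rho> i = tt \<or> \<rho> i = ff" for W \<rho>
    using that
  proof (induction W arbitrary: \<rho> rule: finite_induct)
    case empty
    \<comment> \<open>If \<open>tt\<close> and \<open>ff\<close> coincide, \<open>True\<close>
      stands for both.\<close>
    let ?v = "\<lambda>i. Some (\<rho> i = tt)"
    have \<rho>: "\<rho> i = embed (?v i)" if "i \<in> vars t" for i
      using empty that by (cases "\<rho> i = tt") auto
    have "val \<rho> s = embed (bochvar_eval ?v s)"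
      using val_cong[OF s, of \<rho>] val_embed[OF s] \<rho> vars by metis
    also have "\<dots> = embed (bochvar_eval ?v t)"
      using valid by (simp add: bochvar_valid_def)
    also have "\<dots> = val \<rho> t"
      using val_cong[OF t, of \<rho>] val_embed[OF t] \<rho> by metis
    finally show ?case .
  next
    case (insert i W)
    then have i: "i \<in> vars s" "i \<in> vars t" using vars by auto
    have "val (\<rho>(i := w)) s = val (\<rho>(i := w)) t" if "w = tt \<or> w = ff" for w
      by (rule insert.IH) (use insert.prems that in auto)
    then show ?case
      by (subst (1 2) shannon_expansion[of _ i]) (use s t i in auto)
  qed
  from this[OF finite_vars order_refl] show ?thesis by simp
qed

end

section \<open>Equational logic and Lindenbaum algebras\<close>

text \<open>A homomorphism into the terms over \<open>\<Sigma>\<close> that sends every foreign symbol to \<open>c\<close>.  It shows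
  that foreign symbols do not help in derivations, so that quotients can be taken of the whole type
  of terms.\<close>

primrec interp :: "opsym set \<Rightarrow> tm \<Rightarrow> (nat \<Rightarrow> tm) \<Rightarrow> tm \<Rightarrow> tm" where
  "interp \<Sigma> c \<tau> (Var i) = \<tau> i"
| "interp \<Sigma> c \<tau> TT = (if sT \<in> \<Sigma> then TT else c)"
| "interp \<Sigma> c \<tau> FF = (if sF \<in> \<Sigma> then FF else c)"
| "interp \<Sigma> c \<tau> UU = (if sU \<in> \<Sigma> then UU else c)"
| "interp \<Sigma> c \<tau> (\<^bold>\<not> s) = (if sNeg \<in> \<Sigma> then \<^bold>\<not> interp \<Sigma> c \<tau> s else c)"
| "interp \<Sigma> c \<tau> (s \<^bold>\<and> t) = (if sConj \<in> \<Sigma> then interp \<Sigma> c \<tau> s \<^bold>\<and> interp \<Sigma> c \<tau> t else c)"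
| "interp \<Sigma> c \<tau> (s \<^bold>\<or> t) = (if sDisj \<in> \<Sigma> then interp \<Sigma> c \<tau> s \<^bold>\<or> interp \<Sigma> c \<tau> t else c)"
| "interp \<Sigma> c \<tau> (s \<^bold>\<and>\<^sup>\<bullet> t) = (if sFConj \<in> \<Sigma> then interp \<Sigma> c \<tau> s \<^bold>\<and>\<^sup>\<bullet> interp \<Sigma> c \<tau> t else c)"
| "interp \<Sigma> c \<tau> (s \<^bold>\<or>\<^sup>\<bullet> t) = (if sFDisj \<in> \<Sigma> then interp \<Sigma> c \<tau> s \<^bold>\<or>\<^sup>\<bullet> interp \<Sigma> c \<tau> t else c)"

lemma interp_in_terms_over:
  "c \<in> terms_over \<Sigma> \<Longrightarrow> (\<And>i. \<tau> i \<in> terms_over \<Sigma>) \<Longrightarrow> interp \<Sigma> c \<tau> t \<in> terms_over \<Sigma>"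
  by (induction t) auto

lemma interp_subst: "interp \<Sigma> c \<tau> (subst \<sigma> t) = interp \<Sigma> c (\<lambda>i. interp \<Sigma> c \<tau> (\<sigma> i)) t"
  by (induction t) auto

lemma interp_eq_subst: "t \<in> terms_over \<Sigma> \<Longrightarrow> interp \<Sigma> c \<tau> t = subst \<tau> t"
  by (induction t) auto

lemma subst_Var: "subst Var t = t"
  by (induction t) auto

lemma derives_restrict_signature:
  assumes E: "E \<subseteq> terms_over \<Sigma> \<times> terms_over \<Sigma>"
    and d: "derives UNIV E s t" and st: "s \<in> terms_over \<Sigma>" "t \<in> terms_over \<Sigma>"
  shows "derives \<Sigma> E s t"
proof -
  \<comment> \<open>The assignment is arbitrary because a substitution step changes it. Congruence
    for a foreign connective becomes reflexivity at \<open>c\<close>.\<close>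
  have "derives \<Sigma> E (interp \<Sigma> c \<tau> s) (interp \<Sigma> c \<tau> t)"
    if "c \<in> terms_over \<Sigma>" "\<And>i. \<tau> i \<in> terms_over \<Sigma>" for c \<tau>
    using d that
  proof (induction arbitrary: \<tau>)
    case (axiom s t)
    then have "s \<in> terms_over \<Sigma>" "t \<in> terms_over \<Sigma>" using E by auto
    then show ?case
      using derives.substitution[OF derives.axiom[OF axiom(1)], of \<tau> \<Sigma>] axiom
      by (simp add: interp_eq_subst)
  next
    case (trans s t u)
    then show ?case by (blast intro: derives.trans)
  next
    case (substitution s t \<sigma>)
    then show ?case by (simp add: interp_subst interp_in_terms_over)
  qed (auto intro: derives.intros interp_in_terms_over)
  \<comment> \<open>A variable is a term over every signature, so it can serve as
    \<open>c\<close>.\<close>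
  from this[of "Var 0" Var] show ?thesis
    using st by (simp add: interp_eq_subst subst_Var)
qed

text \<open>A type definition cannot depend on a term; the type class lets the set of axioms be passed as
  a type argument.\<close>

class equational_axioms =
  fixes axs :: "'a itself \<Rightarrow> eqn set"

quotient_type (overloaded) 'a lindenbaum = tm / "derives UNIV (axs TYPE('a::equational_axioms))"
proof (rule equivpI)
  show "reflp (derives UNIV (axs TYPE('a)))"
    by (rule reflpI) (auto intro: derives.refl simp: terms_over_def)
  show "symp (derives UNIV (axs TYPE('a)))"
    by (rule sympI) (rule derives.sym)
  show "transp (derives UNIV (axs TYPE('a)))"
    by (rule transpI) (rule derives.trans)
qed

lift_definition cls :: "tm \<Rightarrow> 'a::equational_axioms lindenbaum" is "\<lambda>t. t" .
lift_definition neg :: "'a::equational_axioms lindenbaum \<Rightarrow> 'a lindenbaum" is Neg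
  by (simp add: derives.cong_Neg)
lift_definition con :: "'a::equational_axioms lindenbaum \<Rightarrow> 'a lindenbaum \<Rightarrow> 'a lindenbaum" is Conj
  by (simp add: derives.cong_Conj)
lift_definition dis :: "'a::equational_axioms lindenbaum \<Rightarrow> 'a lindenbaum \<Rightarrow> 'a lindenbaum" is Disj
  by (simp add: derives.cong_Disj)
lift_definition fcon :: "'a::equational_axioms lindenbaum \<Rightarrow> 'a lindenbaum \<Rightarrow> 'a lindenbaum" is FConj
  by (simp add: derives.cong_FConj)
lift_definition fdis :: "'a::equational_axioms lindenbaum \<Rightarrow> 'a lindenbaum \<Rightarrow> 'a lindenbaum" is FDisj
  by (simp add: derives.cong_FDisj)

lemma cls_eq_iff:
  "(cls s :: 'a::equational_axioms lindenbaum) = cls t \<longleftrightarrow> derives UNIV (axs TYPE('a)) s t"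
  by transfer simp

lemma cls_simps:
  "cls (\<^bold>\<not> s) = neg (cls s)"
  "cls (s \<^bold>\<and> t) = con (cls s) (cls t)"
  "cls (s \<^bold>\<or> t) = dis (cls s) (cls t)"
  "cls (s \<^bold>\<and>\<^sup>\<bullet> t) = fcon (cls s) (cls t)"
  "cls (s \<^bold>\<or>\<^sup>\<bullet> t) = fdis (cls s) (cls t)"
  by (transfer, simp add: derives.refl terms_over_def)+

lemma cls_cases:
  obtains t where "X = cls t"
  by (rule that[of "rep_lindenbaum X"]) (simp add: cls.abs_eq Quotient_abs_rep[OF Quotient_lindenbaum])

lemma derives_instance:
  "(s \<approx> t) \<in> E \<Longrightarrow> derives UNIV E (subst \<sigma> s) (subst \<sigma> t)"
  by (rule derives.substitution) (auto intro: derives.axiom simp: terms_over_def)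

definition assign :: "tm \<Rightarrow> tm \<Rightarrow> tm \<Rightarrow> nat \<Rightarrow> tm" where
  "assign r s t = (\<lambda>i. if i = 0 then r else if i = 1 then s else t)"

lemma assign_simps [simp]:
  "assign r s t 0 = r" "assign r s t (Suc 0) = s" "assign r s t 2 = t"
  by (simp_all add: assign_def)

text \<open>Every law is an axiom instance at representatives of the classes. Requiring only an
  inclusion of axioms covers the extensions by constants too.\<close>

lemma lindenbaum_full_cl_algebra:
  assumes "snd (with_full CL) \<subseteq> axs TYPE('a::equational_axioms)"
  shows "full_cl_algebra (neg :: 'a lindenbaum \<Rightarrow> 'a lindenbaum) con dis fcon fdis"
proof -
  have ax: "cls (subst (assign r s t) l) = (cls (subst (assign r s t) l') :: 'a lindenbaum)"
    if "(l \<approx> l') \<in> snd (with_full CL)" for l l' r s t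
    unfolding cls_eq_iff using assms that by (intro derives_instance) auto
  show ?thesis
  proof
    fix X Y Z :: "'a lindenbaum"
    obtain r s t where [simp]: "X = cls r" "Y = cls s" "Z = cls t"
      by (metis cls_cases)
    note ax = ax[of _ _ r s t, unfolded with_full_def CL_def, simplified]
    show "neg (neg X) = X"
      using ax[of "\<^bold>\<not> \<^bold>\<not> Var 0" "Var 0"] by (simp add: cls_simps)
    show "neg (con X Y) = dis (neg X) (neg Y)"
      using ax[of "\<^bold>\<not> (Var 0 \<^bold>\<and> Var 1)"] by (simp add: cls_simps)
    show "con (con X Y) Z = con X (con Y Z)"
      using ax[of "(Var 0 \<^bold>\<and> Var 1) \<^bold>\<and> Var 2"] by (simp add: cls_simps)
    show "con X (dis Y Z) = dis (con X Y) (con X Z)"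
      using ax[of "Var 0 \<^bold>\<and> (Var 1 \<^bold>\<or> Var 2)"] by (simp add: cls_simps)
    show "con (dis X Y) Z = dis (con X Z) (con (neg X) (con Y Z))"
      using ax[of "(Var 0 \<^bold>\<or> Var 1) \<^bold>\<and> Var 2"] by (simp add: cls_simps)
    show "dis X (con X Y) = X"
      using ax[of "Var 0 \<^bold>\<or> (Var 0 \<^bold>\<and> Var 1)"] by (simp add: cls_simps)
    show "dis (con X Y) (con Y X) = dis (con Y X) (con X Y)"
      using ax[of "(Var 0 \<^bold>\<and> Var 1) \<^bold>\<or> (Var 1 \<^bold>\<and> Var 0)"] by (simp add: cls_simps)
    show "fcon X Y = dis (con X Y) (con Y X)"
      using ax[of "Var 0 \<^bold>\<and>\<^sup>\<bullet> Var 1"] by (simp add: cls_simps)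
    show "fdis X Y = neg (fcon (neg X) (neg Y))"
      using ax[of "Var 0 \<^bold>\<or>\<^sup>\<bullet> Var 1"] by (simp add: cls_simps)
  qed
qed

abbreviation bochvar_axioms :: "eqn set" where
  "bochvar_axioms \<equiv> {S1, S2, S3, S4, S6, S7, S8, S9, S10, S11}"

lemmas bochvar_axiom_defs =
  S1_def S2_def S3_def S4_def S6_def S7_def S8_def S9_def S10_def S11_def

lemma lindenbaum_bochvar_algebra:
  assumes "bochvar_axioms \<subseteq> axs TYPE('a::equational_axioms)"
  shows "bochvar_algebra (neg :: 'a lindenbaum \<Rightarrow> 'a lindenbaum) fcon fdis (cls TT) (cls FF) (cls UU)"
proof -
  have ax: "cls (subst (assign r s t) (fst e)) = (cls (subst (assign r s t) (snd e)) :: 'a lindenbaum)"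
    if "e \<in> bochvar_axioms" for e r s t
    unfolding cls_eq_iff using assms that by (intro derives_instance) auto
  show ?thesis
  proof
    fix X Y Z :: "'a lindenbaum"
    obtain r s t where [simp]: "X = cls r" "Y = cls s" "Z = cls t"
      by (metis cls_cases)
    note ax = ax[of _ r s t]
    show "neg (cls TT) = (cls FF :: 'a lindenbaum)"
      using ax[of S1] by (simp add: S1_def cls_simps)
    show "neg (cls UU) = (cls UU :: 'a lindenbaum)"
      using ax[of S2] by (simp add: S2_def cls_simps)
    show "neg (neg X) = X"
      using ax[of S3] by (simp add: S3_def cls_simps)
    show "neg (fcon X Y) = fdis (neg X) (neg Y)"
      using ax[of S4] by (simp add: S4_def cls_simps)
    show "fcon (fcon X Y) Z = fcon X (fcon Y Z)"
      using ax[of S6] by (simp add: S6_def cls_simps)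
    show "fcon (cls TT) X = X"
      using ax[of S7] by (simp add: S7_def cls_simps)
    show "fdis X (fcon (neg X) Y) = fdis X Y"
      using ax[of S8] by (simp add: S8_def cls_simps)
    show "fcon X Y = fcon Y X"
      using ax[of S9] by (simp add: S9_def cls_simps)
    show "fcon X (fdis Y Z) = fdis (fcon X Y) (fcon X Z)"
      using ax[of S10] by (simp add: S10_def cls_simps)
    show "fcon (cls UU) X = cls UU"
      using ax[of S11] by (simp add: S11_def cls_simps)
  qed
qed

datatype cl_index = CL_index
datatype cl2_index = CL2_index
datatype cl3_index = CL3_index
datatype bochvar_index = Bochvar_index

instantiation cl_index :: equational_axioms
begin
definition "axs_cl_index (_ :: cl_index itself) = snd (with_full CL)"
instance ..
end

instantiation cl2_index :: equational_axioms
begin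
definition "axs_cl2_index (_ :: cl2_index itself) = snd (with_full CL2)"
instance ..
end

instantiation cl3_index :: equational_axioms
begin
definition "axs_cl3_index (_ :: cl3_index itself) = snd (with_full CL3)"
instance ..
end

instantiation bochvar_index :: equational_axioms
begin
definition "axs_bochvar_index (_ :: bochvar_index itself) = bochvar_axioms"
instance ..
end

section \<open>Completeness of the axioms of strict logic\<close>

lemma bochvar_eval_subst:
  "t \<in> terms_over bochvar_sig \<Longrightarrow>
    bochvar_eval v (subst \<sigma> t) = bochvar_eval (\<lambda>i. bochvar_eval v (\<sigma> i)) t"
  by (induction t rule: bochvar_induct) auto

lemma subst_in_terms_over:
  "t \<in> terms_over \<Sigma> \<Longrightarrow> (\<And>i. \<sigma> i \<in> terms_over \<Sigma>) \<Longrightarrow> subst \<sigma> t \<in> terms_over \<Sigma>"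
  by (induction t) auto

lemma bochvar_axioms_terms_over: "bochvar_axioms \<subseteq> terms_over bochvar_sig \<times> terms_over bochvar_sig"
  by (auto simp: bochvar_axiom_defs bochvar_sig_def)

lemma bochvar_axioms_valid: "e \<in> bochvar_axioms \<Longrightarrow> bochvar_valid e"
  by (auto simp: bochvar_axiom_defs bochvar_valid_def strict2_def
      map_option_case split: option.splits Option.bind_splits)

text \<open>Membership in the strict terms is carried along because
  \<open>bochvar_eval_subst\<close> requires it.\<close>

lemma bochvar_sound:
  assumes "derives bochvar_sig bochvar_axioms s t"
  shows "s \<in> terms_over bochvar_sig \<and> t \<in> terms_over bochvar_sig \<and> bochvar_valid (s \<approx> t)"
  using assms
proof (induction rule: derives.induct)
  case (axiom s t)
  then show ?case using bochvar_axioms_terms_over bochvar_axioms_valid by blast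
next
  case (substitution s t \<sigma>)
  then show ?case
    by (auto simp: bochvar_valid_def bochvar_eval_subst subst_in_terms_over)
qed (auto simp: bochvar_valid_def bochvar_sig_def)

lemma bochvar_complete:
  assumes s: "s \<in> terms_over bochvar_sig" and t: "t \<in> terms_over bochvar_sig"
    and valid: "bochvar_valid (s \<approx> t)"
  shows "derives bochvar_sig bochvar_axioms s t"
proof -
  interpret bochvar_algebra
    "neg :: bochvar_index lindenbaum \<Rightarrow> _" fcon fdis "cls TT" "cls FF" "cls UU"
    by (rule lindenbaum_bochvar_algebra) (simp add: axs_bochvar_index_def)
  \<comment> \<open>Under the generic assignment a strict term evaluates to its own class, so equal
    values mean derivability.\<close>
  have cls_val: "cls r = val (\<lambda>i. cls (Var i)) r" if "r \<in> terms_over bochvar_sig" for r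
    using that by (induction r rule: bochvar_induct) (auto simp: cls_simps)
  have "(cls s :: bochvar_index lindenbaum) = cls t"
    unfolding cls_val[OF s] cls_val[OF t] by (rule val_eq_if_bochvar_valid[OF s t valid])
  then have "derives UNIV bochvar_axioms s t"
    by (simp add: cls_eq_iff axs_bochvar_index_def)
  then show ?thesis
    by (rule derives_restrict_signature[OF bochvar_axioms_terms_over _ s t])
qed

lemma completely_axiomatises_bochvar_axioms: "completely_axiomatises_bochvar bochvar_axioms"
  unfolding completely_axiomatises_bochvar_def proves_def fst_conv snd_conv
  by (intro ballI iffI bochvar_complete) (blast dest: bochvar_sound)+

section \<open>The strict axioms in conditional logic\<close>

lemmas cl_defs = with_full_def CL3_def CL2_def CL_def

lemma proves_if_cls_eq:
  assumes "axs TYPE('a::equational_axioms) = snd Th"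
    and "snd Th \<subseteq> terms_over (fst Th) \<times> terms_over (fst Th)"
    and "fst e \<in> terms_over (fst Th)" "snd e \<in> terms_over (fst Th)"
    and "cls (fst e) = (cls (snd e) :: 'a lindenbaum)"
  shows "Th \<turnstile> e"
  unfolding proves_def
  by (rule derives_restrict_signature) (use assms in \<open>simp_all add: cls_eq_iff\<close>)

text \<open>One computation serves all three theories; the laws about \<open>TT\<close> and
  \<open>UU\<close> are conditional on the axioms for these constants.\<close>

lemma cls_eq_strict_axioms:
  assumes ax: "snd (with_full CL) \<subseteq> axs TYPE('a::equational_axioms)"
  shows "e \<in> {S3, S4, S6, S8, S9, S10} \<Longrightarrow> cls (fst e) = (cls (snd e) :: 'a lindenbaum)"
    and "(TT \<^bold>\<and> Var 0 \<approx> Var 0) \<in> axs TYPE('a) \<Longrightarrow> cls (fst S7) = (cls (snd S7) :: 'a lindenbaum)"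
    and "(\<^bold>\<not> UU \<approx> UU) \<in> axs TYPE('a) \<Longrightarrow> cls (fst S11) = (cls (snd S11) :: 'a lindenbaum)"
proof -
  interpret full_cl_algebra "neg :: 'a lindenbaum \<Rightarrow> _" con dis fcon fdis
    by (rule lindenbaum_full_cl_algebra[OF ax])
  show "cls (fst e) = (cls (snd e) :: 'a lindenbaum)" if "e \<in> {S3, S4, S6, S8, S9, S10}"
  proof -
    have "cls (fst S9) = (cls (snd S9) :: 'a lindenbaum)"
      by (simp add: S9_def cls_simps fc_comm)
    moreover have "\<forall>e \<in> {S3, S4, S6, S8, S10}. cls (fst e) = (cls (snd e) :: 'a lindenbaum)"
      by (simp add: S3_def S4_def S6_def S8_def S10_def cls_simps n_fc fc_assoc fd_fc_absorb fc_fd)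
    ultimately show ?thesis using that by blast
  qed
  show "cls (fst S7) = (cls (snd S7) :: 'a lindenbaum)" if "(TT \<^bold>\<and> Var 0 \<approx> Var 0) \<in> axs TYPE('a)"
  proof -
    have "con (cls TT) X = X" for X :: "'a lindenbaum"
    proof (cases X rule: cls_cases)
      case (1 t)
      then show ?thesis
        using derives_instance[OF that, of "\<lambda>i. t"] by (simp add: cls_eq_iff flip: cls_simps)
    qed
    then show ?thesis by (simp add: S7_def cls_simps fc_neutral)
  qed
  show "cls (fst S11) = (cls (snd S11) :: 'a lindenbaum)" if "(\<^bold>\<not> UU \<approx> UU) \<in> axs TYPE('a)"
  proof -
    have "neg (cls UU) = (cls UU :: 'a lindenbaum)"
      using derives.axiom[OF that] by (simp add: cls_eq_iff flip: cls_simps)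
    then show ?thesis by (simp add: S11_def cls_simps fc_undefined)
  qed
qed

lemma with_full_axioms_terms_over:
  "snd (with_full CL) \<subseteq> terms_over (fst (with_full CL)) \<times> terms_over (fst (with_full CL))"
  "snd (with_full CL2) \<subseteq> terms_over (fst (with_full CL2)) \<times> terms_over (fst (with_full CL2))"
  "snd (with_full CL3) \<subseteq> terms_over (fst (with_full CL3)) \<times> terms_over (fst (with_full CL3))"
  by (simp_all add: cl_defs)

lemma CL_proves:
  assumes "e \<in> {S3, S4, S6, S8, S9, S10}"
  shows "with_full CL \<turnstile> e"
proof (rule proves_if_cls_eq[OF axs_cl_index_def with_full_axioms_terms_over(1)])
  show "cls (fst e) = (cls (snd e) :: cl_index lindenbaum)"
    by (rule cls_eq_strict_axioms(1)[OF _ assms]) (simp add: axs_cl_index_def)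
qed (use assms in \<open>elim insertE emptyE; simp add: cl_defs bochvar_axiom_defs\<close>)+

lemma CL2_proves:
  assumes "e \<in> {S1, S3, S4, S6, S7, S8, S9, S10}"
  shows "with_full CL2 \<turnstile> e"
proof (rule proves_if_cls_eq[OF axs_cl2_index_def with_full_axioms_terms_over(2)])
  have ax: "snd (with_full CL) \<subseteq> axs TYPE(cl2_index)" "S1 \<in> axs TYPE(cl2_index)"
    "(TT \<^bold>\<and> Var 0 \<approx> Var 0) \<in> axs TYPE(cl2_index)"
    unfolding axs_cl2_index_def with_full_def CL2_def S1_def fst_conv snd_conv by blast+
  then have "cls (fst S1) = (cls (snd S1) :: cl2_index lindenbaum)"
    by (simp add: cls_eq_iff derives.axiom)
  then show "cls (fst e) = (cls (snd e) :: cl2_index lindenbaum)"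
    using assms cls_eq_strict_axioms[OF ax(1)] ax(3) by blast
qed (use assms in \<open>elim insertE emptyE; simp add: cl_defs bochvar_axiom_defs\<close>)+

lemma CL3_proves:
  assumes "e \<in> bochvar_axioms"
  shows "with_full CL3 \<turnstile> e"
proof (rule proves_if_cls_eq[OF axs_cl3_index_def with_full_axioms_terms_over(3)])
  have ax: "snd (with_full CL) \<subseteq> axs TYPE(cl3_index)" "S1 \<in> axs TYPE(cl3_index)"
    "S2 \<in> axs TYPE(cl3_index)" "(TT \<^bold>\<and> Var 0 \<approx> Var 0) \<in> axs TYPE(cl3_index)"
    "(\<^bold>\<not> UU \<approx> UU) \<in> axs TYPE(cl3_index)"
    unfolding axs_cl3_index_def with_full_def CL3_def CL2_def S1_def S2_def fst_conv snd_conv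
    by blast+
  then have "cls (fst S1) = (cls (snd S1) :: cl3_index lindenbaum)"
    "cls (fst S2) = (cls (snd S2) :: cl3_index lindenbaum)"
    by (simp_all add: cls_eq_iff derives.axiom)
  then show "cls (fst e) = (cls (snd e) :: cl3_index lindenbaum)"
    using assms cls_eq_strict_axioms[OF ax(1)] ax(4,5) by blast
qed (use assms in \<open>elim insertE emptyE; simp add: cl_defs bochvar_axiom_defs\<close>)+

theorem mainTheorem5:
  "(\<forall>e \<in> {S1, S2, S3, S4, S6, S7, S8, S9, S10, S11}. with_full CL3 \<turnstile> e) \<and>
   completely_axiomatises_bochvar {S1, S2, S3, S4, S6, S7, S8, S9, S10, S11} \<and>
   (\<forall>e \<in> {S1, S3, S4, S6, S7, S8, S9}. with_full CL2 \<turnstile> e) \<and>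
   (\<forall>e \<in> {S3, S4, S8, S9, S10}. with_full CL \<turnstile> e)"
  by (intro conjI ballI completely_axiomatises_bochvar_axioms CL3_proves CL2_proves CL_proves) auto

end
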